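(* Let $M\subseteq N$ and $N\setminus M=D\cup E$ with $D\cap E=\emptyset$. If $m\in\mathcal{K}(N)$ then $T_{-D|E}(m)\in\mathcal{K}(M)$, and the independency model induced by $T_{-D|E}(m)$ is given by $$a\perp b\mid C\ [T_{-D|E}(m)]\iff a\perp b\mid C\cup E\ [m]\qquad\text{for any }\langle a,b|C\rangle\in\mathcal{E}(M).$$ In particular, $T_{-D|E}$ maps $\mathcal{K}(N)$ linearly into $\mathcal{K}(M)$.
   Context: $N$ is a finite set with $|N|\ge 2$ and $\mathcal{P}(N)$ is its power set; a singleton $\{a\}$ is written $a$. $\mathbb{R}^{\mathcal{P}(N)}$ is the space of functions $m:\mathcal{P}(N)\to\mathbb{R}$. A function $m$ is supermodular if $m(A)+m(B)\le m(A\cup B)+m(A\cap B)$ for all $A,B\subseteq N$; $\mathcal{K}(N)$ is the cone of supermodular functions. $\mathcal{E}(N)$ is the set of triplets $\langle a,b|C\rangle$ with $a,b\in N$ distinct and $C\subseteq N\setminus\{a,b\}$. For $m\in\mathbb{R}^{\mathcal{P}(N)}$, $a\perp b\mid C\ [m]$ means $m(a\cup b\cup C)+m(C)-m(a\cup C)-m(b\cup C)=0$; the independency model induced by $m\in\mathcal{K}(N)$ is the set of $\langle a,b|C\rangle\in\mathcal{E}(N)$ with $a\perp b\mid C\ [m]$. The same definitions are used for other finite sets in place of $N$. The minor projection with deleting of $D$ and extracting of $E$ is the map $T_{-D|E}:\mathbb{R}^{\mathcal{P}(N)}\to\mathbb{R}^{\mathcal{P}(M)}$, $[T_{-D|E}(m)](S)=m(S\cup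 E)$ for $S\subseteq M$. *)

theory Defs
  imports Complex_Main "HOL-Library.FuncSet"
begin

text \<open>
  The space of real functions on the power set of a finite set is modelled by extensional
  functions, so that equality of its elements is equality on the power set.
\<close>

definition setfuns :: "'a set \<Rightarrow> ('a set \<Rightarrow> real) set" where
  "setfuns N = Pow N \<rightarrow>\<^sub>E UNIV"

definition setfun_add ::
  "'a set \<Rightarrow> ('a set \<Rightarrow> real) \<Rightarrow> ('a set \<Rightarrow> real) \<Rightarrow> ('a set \<Rightarrow> real)" where
  "setfun_add N m m' = (\<lambda>S\<in>Pow N. m S + m' S)"

definition setfun_scale :: "'a set \<Rightarrow> real \<Rightarrow> ('a set \<Rightarrow> real) \<Rightarrow> ('a set \<Rightarrow> real)" where
  "setfun_scale N c m = (\<lambda>S\<in>Pow N. c * m S)"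

text \<open>
  The library predicate \<open>linear\<close> covers maps between whole types only,
  hence this version relative to the carriers \<open>setfuns N\<close> and \<open>setfuns M\<close>.
\<close>

definition setfun_linear ::
  "'a set \<Rightarrow> 'a set \<Rightarrow> (('a set \<Rightarrow> real) \<Rightarrow> ('a set \<Rightarrow> real)) \<Rightarrow> bool" where
  "setfun_linear N M T \<longleftrightarrow>
     T \<in> setfuns N \<rightarrow> setfuns M \<and>
     (\<forall>m\<in>setfuns N. \<forall>m'\<in>setfuns N. T (setfun_add N m m') = setfun_add M (T m) (T m')) \<and>
     (\<forall>c. \<forall>m\<in>setfuns N. T (setfun_scale N c m) = setfun_scale M c (T m))"

definition supermodular :: "'a set \<Rightarrow> ('a set \<Rightarrow> real) \<Rightarrow> bool" where
  "supermodular N m \<longleftrightarrow> (\<forall>A B. A \<subseteq> N \<and> B \<subseteq> N \<longrightarrow> m A + m B \<le> m (A \<union> B) + m (A \<inter> B))"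

definition supermodular_cone :: "'a set \<Rightarrow> ('a set \<Rightarrow> real) set" where
  "supermodular_cone N = {m \<in> setfuns N. supermodular N m}"

definition triplets :: "'a set \<Rightarrow> ('a \<times> 'a \<times> 'a set) set" where
  "triplets N = {(a, b, C). a \<in> N \<and> b \<in> N \<and> a \<noteq> b \<and> C \<subseteq> N - {a, b}}"

definition indep :: "('a set \<Rightarrow> real) \<Rightarrow> 'a \<Rightarrow> 'a \<Rightarrow> 'a set \<Rightarrow> bool" where
  "indep m a b C \<longleftrightarrow> m ({a} \<union> {b} \<union> C) + m C - m ({a} \<union> C) - m ({b} \<union> C) = 0"

definition indep_model :: "'a set \<Rightarrow> ('a set \<Rightarrow> real) \<Rightarrow> ('a \<times> 'a \<times> 'a set) set" where
  "indep_model N m = {(a, b, C) \<in> triplets N. indep m a b C}"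

text \<open>
  The minor projection deleting \<open>D\<close> and extracting \<open>E\<close>; its target is the space of functions
  on the power set of the remaining set \<open>N - (D \<union> E)\<close>.
\<close>

definition minor_proj ::
  "'a set \<Rightarrow> 'a set \<Rightarrow> 'a set \<Rightarrow> ('a set \<Rightarrow> real) \<Rightarrow> ('a set \<Rightarrow> real)" where
  "minor_proj N D E m = (\<lambda>S\<in>Pow (N - (D \<union> E)). m (S \<union> E))"

end

theory Submission
  imports Defs
begin

text \<open>The projection is precomposition with \<open>S \<mapsto> S \<union> E\<close>, a map
  from subsets of \<open>M\<close> to subsets of \<open>N\<close> that preserves unions and
  intersections. Hence supermodularity pulls back (\<open>supermodular_minor_proj\<close>), the
  four-term expression in \<open>indep\<close> at \<open>C\<close> becomes that of \<open>m\<close>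
  at \<open>C \<union> E\<close> (\<open>indep_minor_proj_iff\<close>), and linearity holds
  pointwise (\<open>setfun_linear_minor_proj\<close>).\<close>

lemma minor_proj_apply:
  "S \<subseteq> N - (D \<union> E) \<Longrightarrow> minor_proj N D E m S = m (S \<union> E)"
  by (simp add: minor_proj_def)

lemma minor_proj_in_setfuns: "minor_proj N D E m \<in> setfuns (N - (D \<union> E))"
  by (simp add: minor_proj_def setfuns_def)

lemma supermodular_minor_proj:
  assumes "supermodular N m" "E \<subseteq> N"
  shows "supermodular (N - (D \<union> E)) (minor_proj N D E m)"
  unfolding supermodular_def
proof (intro allI impI)
  fix A B assume AB: "A \<subseteq> N - (D \<union> E) \<and> B \<subseteq> N - (D \<union> E)"
  then have "A \<union> E \<subseteq> N" "B \<union> E \<subseteq> N"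
    using assms(2) by auto
  then have "m (A \<union> E) + m (B \<union> E)
      \<le> m ((A \<union> E) \<union> (B \<union> E)) + m ((A \<union> E) \<inter> (B \<union> E))"
    using assms(1) unfolding supermodular_def by blast
  \<comment> \<open>Adjoining \<open>E\<close> commutes with both lattice operations; for the
    intersection this is distributivity.\<close>
  moreover have "(A \<union> E) \<union> (B \<union> E) = (A \<union> B) \<union> E" "(A \<union> E) \<inter> (B \<union> E) = (A \<inter> B) \<union> E"
    by auto
  moreover have "A \<union> B \<subseteq> N - (D \<union> E)" "A \<inter> B \<subseteq> N - (D \<union> E)"
    using AB by auto
  ultimately show "minor_proj N D E m A + minor_proj N D E m B
      \<le> minor_proj N D E m (A \<union> B) + minor_proj N D E m (A \<inter> B)"
    using AB by (simp add: minor_proj_apply)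
qed

lemma minor_proj_in_supermodular_cone:
  assumes "m \<in> supermodular_cone N" "E \<subseteq> N"
  shows "minor_proj N D E m \<in> supermodular_cone (N - (D \<union> E))"
  using assms by (simp add: supermodular_cone_def minor_proj_in_setfuns supermodular_minor_proj)

lemma indep_minor_proj_iff:
  assumes "(a, b, C) \<in> triplets (N - (D \<union> E))"
  shows "indep (minor_proj N D E m) a b C \<longleftrightarrow> indep m a b (C \<union> E)"
proof -
  \<comment> \<open>All four arguments in \<open>indep\<close> lie in the domain of the projection,
    so none of its values is the default \<open>undefined\<close>.\<close>
  have "{a} \<union> {b} \<union> C \<subseteq> N - (D \<union> E)" "C \<subseteq> N - (D \<union> E)"
      "{a} \<union> C \<subseteq> N - (D \<union> E)" "{b} \<union> C \<subseteq> N - (D \<union> E)"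
    using assms by (auto simp: triplets_def)
  then show ?thesis
    unfolding indep_def by (simp add: minor_proj_apply)
qed

lemma setfun_linear_minor_proj:
  assumes "E \<subseteq> N"
  shows "setfun_linear N (N - (D \<union> E)) (minor_proj N D E)"
proof -
  \<comment> \<open>The sum and the scalar multiple on \<open>N\<close> are restricted to
    \<open>Pow N\<close>; this inclusion lets them be evaluated at \<open>S \<union> E\<close>.
    Outside the smaller power set both sides are \<open>undefined\<close>.\<close>
  have "S \<union> E \<subseteq> N" if "S \<subseteq> N - (D \<union> E)" for S
    using that assms by auto
  then show ?thesis
    unfolding setfun_linear_def
    by (simp add: minor_proj_in_setfuns)
      (simp add: minor_proj_def setfun_add_def setfun_scale_def fun_eq_iff restrict_def)
qed

theorem mainTheorem5:
  fixes N M D E :: "'a set"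
  assumes "finite N" and "card N \<ge> 2"
    and "M \<subseteq> N" and "N - M = D \<union> E" and "D \<inter> E = {}"
  shows "(\<forall>m\<in>supermodular_cone N.
            minor_proj N D E m \<in> supermodular_cone M \<and>
            indep_model M (minor_proj N D E m) = {(a, b, C) \<in> triplets M. indep m a b (C \<union> E)} \<and>
            (\<forall>(a, b, C)\<in>triplets M.
               indep (minor_proj N D E m) a b C \<longleftrightarrow> indep m a b (C \<union> E))) \<and>
         setfun_linear N M (minor_proj N D E) \<and>
         minor_proj N D E ` supermodular_cone N \<subseteq> supermodular_cone M"
proof -
  \<comment> \<open>This identifies \<open>M\<close> with the carrier built into
    \<open>minor_proj\<close>, so the lemmas carry over by rewriting.\<close>
  have M: "M = N - (D \<union> E)" and E: "E \<subseteq> N"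
    using assms(3,4) by blast+
  have cone: "minor_proj N D E m \<in> supermodular_cone M" if "m \<in> supermodular_cone N" for m
    using minor_proj_in_supermodular_cone[OF that E] by (simp add: M)
  have ind: "indep (minor_proj N D E m) a b C \<longleftrightarrow> indep m a b (C \<union> E)"
    if "(a, b, C) \<in> triplets M" for m a b C
    using indep_minor_proj_iff that by (simp add: M)
  have "setfun_linear N M (minor_proj N D E)"
    using setfun_linear_minor_proj[OF E] by (simp add: M)
  moreover have "indep_model M (minor_proj N D E m)
      = {(a, b, C) \<in> triplets M. indep m a b (C \<union> E)}" for m
    using ind by (auto simp: indep_model_def)
  ultimately show ?thesis
    using cone ind by blast
qed

end
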